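(* Let $m\ge 2$, $n,\ell\ge 1$ be integers, let $\Omega:\mathbb{R}^n\rightrightarrows\mathbb{R}^\ell$ be a set-valued mapping with nonempty closed values, for each $\omega\in\mathbb{R}^\ell$ let $\mathcal{B}(\omega)$ be a real tensor of order $m$ and dimension $n$, and let $p:\mathbb{R}^\ell\to\mathbb{R}^n$ be a mapping. Suppose there exists a bounded set $K\subset\mathbb{R}^\ell$ such that $\Omega(v)\subset K$ for all $v\in\mathbb{R}^n$ and such that $\omega\mapsto\mathcal{B}(\omega)$ and $p$ are continuous on $K$. If the set of tensors $\{\mathcal{B}(\omega):\omega\in\Omega(v)\}$ has the limit-$R_0$ property, then the merit function $$r(v)=\min_{\omega\in\Omega(v)}\big\|\min\{v,\ \mathcal{B}(\omega)v^{m-1}+p(\omega)\}\big\|,\qquad v\in\mathbb{R}^n,$$ is level bounded.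
   Context: A real tensor of order $m$ and dimension $n$ is an array $\mathcal{B}=(b_{i_1\ldots i_m})$ of real numbers with $i_j\in\{1,\ldots,n\}$; continuity of $\mathcal{B}(\omega)$ means continuity of every entry. For $v\in\mathbb{R}^n$, $\mathcal{B}v^{m-1}\in\mathbb{R}^n$ is the vector with components $(\mathcal{B}v^{m-1})_i=\sum_{i_2,\ldots,i_m=1}^n b_{i i_2\ldots i_m}v_{i_2}\cdots v_{i_m}$, and $\mathcal{B}v^m=v^T\mathcal{B}v^{m-1}\in\mathbb{R}$. Vector inequalities and the minimum of two vectors are componentwise; $\|\cdot\|$ is the Euclidean norm. A set-valued mapping $\Omega:\mathbb{R}^n\rightrightarrows\mathbb{R}^\ell$ assigns to each $v\in\mathbb{R}^n$ a subset $\Omega(v)\subseteq\mathbb{R}^\ell$. $\limsup_{x\to\infty}\Omega(x)$ is the set of all $u\in\mathbb{R}^\ell$ for which there exist a sequence $x^k\in\mathbb{R}^n$ with $\|x^k\|\to\infty$ and a sequence $u^k\to u$ with $u^k\in\Omega(x^k)$. The set of tensors $\{\mathcal{B}(\omega):\omega\in\Omega(v)\}$ has the limit-$R_0$ property if: whenever $v\in\mathbb{R}^n$ satisfies $v\ge 0$, $\mathcal{B}(\omega)v^{m-1}\ge 0$ and $\mathcal{B}(\omega)v^m=0$ for some $\omega\in\limsup_{x\to\infty}\Omega(x)$, then $v=0$. A function $f:\mathbb{R}^n\to\mathbb{R}$ is level bounded if for every $\alpha\ge 0$ the level set $\{v\in\mathbb{R}^n:f(v)\le\alpha\}$ is bo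unded.
   Formalization: Continuity of B(ω) and p is assumed on the closure of K rather than only on K; with K not closed the claim fails, e.g. n=ℓ=1, m=2, K=(0,1), Ω(v)={1/(2+|v|)}, B(ω)=ω for ω≠0, B(0)=1, p=0. *)

theory Defs
  imports "HOL-Analysis.Analysis"
begin

text \<open>A real tensor of order \<open>m\<close> and dimension \<open>CARD('n)\<close> is represented by its entries: the entry
  with indices \<open>i\<^sub>1, \<dots>, i\<^sub>m\<close> is \<open>b [i\<^sub>1, \<dots>, i\<^sub>m]\<close>. The order is not part of the type, so it is passed
  explicitly, and values of \<open>b\<close> at lists of any other length carry no meaning.\<close>

type_synonym 'n tensor = "'n list \<Rightarrow> real"

definition tensor_continuous_on ::
    "nat \<Rightarrow> (real ^ 'l) set \<Rightarrow> (real ^ 'l \<Rightarrow> 'n::finite tensor) \<Rightarrow> bool" where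
  "tensor_continuous_on m S B \<longleftrightarrow>
     (\<forall>is. length is = m \<longrightarrow> continuous_on S (\<lambda>\<omega>. B \<omega> is))"

text \<open>The vector \<open>b v\<^sup>m\<^sup>-\<^sup>1\<close> and the number \<open>b v\<^sup>m\<close>, for a tensor \<open>b\<close> of order \<open>m\<close>.\<close>

definition tensor_vec :: "nat \<Rightarrow> 'n::finite tensor \<Rightarrow> real ^ 'n \<Rightarrow> real ^ 'n" where
  "tensor_vec m b v =
     (\<chi> i. \<Sum>is | length is = m - 1. b (i # is) * (\<Prod>j\<leftarrow>is. v $ j))"

definition tensor_form :: "nat \<Rightarrow> 'n::finite tensor \<Rightarrow> real ^ 'n \<Rightarrow> real" where
  "tensor_form m b v = v \<bullet> tensor_vec m b v"

text \<open>Points of \<open>limsup_at_infinity \<Omega>\<close> need not lie in any value of \<open>\<Omega>\<close>: when all values of \<open>\<Omega>\<close> are contained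
  in a set \<open>K\<close>, they are only known to lie in \<open>closure K\<close>. Tensors at such points enter the
  limit-\<open>R\<^sub>0\<close> property below, so they are related to those at points of \<open>K\<close> only by continuity on
  \<open>closure K\<close>, not by continuity on \<open>K\<close>.\<close>

definition limsup_at_infinity :: "(real ^ 'n \<Rightarrow> (real ^ 'l) set) \<Rightarrow> (real ^ 'l) set" where
  "limsup_at_infinity \<Omega> =
     {u. \<exists>x w. filterlim (\<lambda>k. norm (x k)) at_top sequentially \<and>
               (\<forall>k. w k \<in> \<Omega> (x k)) \<and> w \<longlonglongrightarrow> u}"

text \<open>The order on \<^typ>\<open>real ^ 'n\<close> is componentwise.\<close>

definition limit_R0 ::
    "nat \<Rightarrow> (real ^ 'l \<Rightarrow> 'n::finite tensor) \<Rightarrow> (real ^ 'n \<Rightarrow> (real ^ 'l) set) \<Rightarrow> bool" where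
  "limit_R0 m B \<Omega> \<longleftrightarrow>
     (\<forall>v. (\<exists>\<omega>\<in>limsup_at_infinity \<Omega>.
             0 \<le> v \<and> 0 \<le> tensor_vec m (B \<omega>) v \<and> tensor_form m (B \<omega>) v = 0) \<longrightarrow> v = 0)"

text \<open>Not \<^const>\<open>min\<close> at type \<^typ>\<open>real ^ 'n\<close>, whose order is not total.\<close>

definition vec_min :: "real ^ 'n \<Rightarrow> real ^ 'n \<Rightarrow> real ^ 'n" where
  "vec_min x y = (\<chi> i. min (x $ i) (y $ i))"

definition residual ::
    "nat \<Rightarrow> (real ^ 'l \<Rightarrow> 'n::finite tensor) \<Rightarrow> (real ^ 'l \<Rightarrow> real ^ 'n) \<Rightarrow>
     real ^ 'n \<Rightarrow> real ^ 'l \<Rightarrow> real" where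
  "residual m B p v \<omega> = norm (vec_min v (tensor_vec m (B \<omega>) v + p \<omega>))"

text \<open>The minimum of the residual over \<open>\<Omega> v\<close>. It is attained when \<open>\<Omega> v\<close> is nonempty and compact
  and the data are continuous on it: see \<open>merit_is_minimum\<close> below.\<close>

definition merit ::
    "nat \<Rightarrow> (real ^ 'l \<Rightarrow> 'n::finite tensor) \<Rightarrow> (real ^ 'l \<Rightarrow> real ^ 'n) \<Rightarrow>
     (real ^ 'n \<Rightarrow> (real ^ 'l) set) \<Rightarrow> real ^ 'n \<Rightarrow> real" where
  "merit m B p \<Omega> v = (LEAST t. t \<in> residual m B p v ` \<Omega> v)"

definition level_bounded :: "(real ^ 'n \<Rightarrow> real) \<Rightarrow> bool" where
  "level_bounded f \<longleftrightarrow> (\<forall>\<alpha>\<ge>0. bounded {v. f v \<le> \<alpha>})"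

lemma continuous_on_residual:
  assumes "m \<ge> 1" "tensor_continuous_on m S B" "continuous_on S p"
  shows "continuous_on S (residual m B p v)"
proof -
  have "continuous_on S (\<lambda>\<omega>. B \<omega> (i # is))" if "length is = m - 1" for i "is"
    using assms(1,2) that by (auto simp: tensor_continuous_on_def)
  then have *: "continuous_on S (\<lambda>\<omega>. tensor_vec m (B \<omega>) v)"
    unfolding tensor_vec_def by (intro continuous_intros) auto
  show ?thesis
    unfolding residual_def vec_min_def using assms(3) *
    by (intro continuous_intros) auto
qed

lemma merit_is_minimum:
  assumes "m \<ge> 1" "compact (\<Omega> v)" "\<Omega> v \<noteq> {}"
    and "tensor_continuous_on m (\<Omega> v) B" "continuous_on (\<Omega> v) p"
  shows "merit m B p \<Omega> v \<in> residual m B p v ` \<Omega> v"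
    and "\<And>\<omega>. \<omega> \<in> \<Omega> v \<Longrightarrow> merit m B p \<Omega> v \<le> residual m B p v \<omega>"
proof -
  obtain z where z: "z \<in> \<Omega> v" "\<And>\<omega>. \<omega> \<in> \<Omega> v \<Longrightarrow> residual m B p v z \<le> residual m B p v \<omega>"
    using continuous_attains_inf[OF assms(2,3) continuous_on_residual[OF assms(1,4,5)]] by blast
  have "merit m B p \<Omega> v = residual m B p v z"
    unfolding merit_def by (rule Least_equality) (use z in auto)
  then show "merit m B p \<Omega> v \<in> residual m B p v ` \<Omega> v"
    and "\<And>\<omega>. \<omega> \<in> \<Omega> v \<Longrightarrow> merit m B p \<Omega> v \<le> residual m B p v \<omega>"
    using z by auto
qed

end

theory Submission
  imports Defs
begin

text \<open>If a level set were unbounded, there would be \<open>v\<^sub>k\<close> with \<open>t\<^sub>k = \<parallel>v\<^sub>k\<parallel> \<rightarrow> \<infinity>\<close> and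
  \<open>\<omega>\<^sub>k \<in> \<Omega> v\<^sub>k\<close> with bounded residuals. Dividing the first argument of each componentwise minimum
  by \<open>t\<^sub>k\<close> and the second by the larger number \<open>t\<^sub>k\<^sup>m\<^sup>-\<^sup>1\<close> makes the residuals tend to \<open>0\<close>.
  By compactness \<open>v\<^sub>k / t\<^sub>k \<rightarrow> d\<close> with \<open>\<parallel>d\<parallel> = 1\<close> and \<open>\<omega>\<^sub>k \<rightarrow> \<omega>\<close> along a subsequence, so
  \<open>min {d, B(\<omega>) d\<^sup>m\<^sup>-\<^sup>1} = 0\<close>, which contradicts the limit-\<open>R\<^sub>0\<close> property.\<close>

lemma tensor_vec_scaleR:
  "tensor_vec m b (c *\<^sub>R v) = c ^ (m - 1) *\<^sub>R tensor_vec m b v"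
proof -
  have "(\<Prod>j\<leftarrow>is. c * v $ j) = c ^ length is * (\<Prod>j\<leftarrow>is. v $ j)" for "is"
    by (induction "is") auto
  then show ?thesis
    by (simp add: tensor_vec_def vec_eq_iff sum_distrib_left mult.left_commute)
qed

lemma tendsto_tensor_vec:
  assumes "m \<ge> 1" and "\<And>is. length is = m \<Longrightarrow> ((\<lambda>k. b k is) \<longlongrightarrow> c is) F" and "(v \<longlongrightarrow> d) F"
  shows "((\<lambda>k. tensor_vec m (b k) (v k)) \<longlongrightarrow> tensor_vec m c d) F"
proof -
  have prod: "((\<lambda>k. \<Prod>j\<leftarrow>is. v k $ j) \<longlongrightarrow> (\<Prod>j\<leftarrow>is. d $ j)) F" for "is"
    by (induction "is") (auto intro!: tendsto_intros assms)
  have "((\<lambda>k. b k (i # is)) \<longlongrightarrow> c (i # is)) F" if "length is = m - 1" for i "is"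
    using assms(1,2) that by auto
  with prod show ?thesis
    unfolding tensor_vec_def by (intro tendsto_vec_lambda tendsto_sum tendsto_mult) auto
qed

text \<open>The hypothesis means that both numbers are at least -\<alpha> and one is at most
  \<alpha>. This survives unequal divisors, and \<open>\<alpha> / s \<le> \<alpha> / t\<close>, so
  the two arguments may be scaled by different powers of a norm.\<close>

lemma abs_min_divide_le:
  fixes a b s t :: real
  assumes "\<bar>min a b\<bar> \<le> \<alpha>" "0 < t" "t \<le> s"
  shows "\<bar>min (a / t) (b / s)\<bar> \<le> \<alpha> / t"
proof -
  have \<alpha>: "0 \<le> \<alpha>" "- \<alpha> \<le> a" "- \<alpha> \<le> b" "a \<le> \<alpha> \<or> b \<le> \<alpha>"
    using assms(1) by linarith+
  have st: "\<alpha> / s \<le> \<alpha> / t"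
    using \<alpha>(1) assms by (simp add: frac_le)
  have "- \<alpha> / t \<le> a / t" "- \<alpha> / s \<le> b / s"
    using \<alpha> assms by (intro divide_right_mono; linarith)+
  moreover have "a / t \<le> \<alpha> / t \<or> b / s \<le> \<alpha> / s"
    using \<alpha>(4) assms by (auto intro!: divide_right_mono)
  ultimately show ?thesis
    using st by (auto simp: abs_le_iff min_def)
qed

text \<open>Every term of the inner product has a zero factor. This turns the limiting equation into
  the premises of \<open>limit_R0\<close>.\<close>

lemma tensor_complementarity:
  assumes "\<And>i. min (v $ i) (tensor_vec m b v $ i) = 0"
  shows "0 \<le> v" "0 \<le> tensor_vec m b v" "tensor_form m b v = 0"
proof -
  have nonneg: "0 \<le> v $ i" "0 \<le> tensor_vec m b v $ i" for i
    using assms[of i] by linarith+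
  then show "0 \<le> v" "0 \<le> tensor_vec m b v"
    by (auto simp: less_eq_vec_def)
  have "v $ i * tensor_vec m b v $ i = 0" for i
    using assms[of i] by (auto simp: min_def split: if_splits)
  then show "tensor_form m b v = 0"
    unfolding tensor_form_def inner_vec_def by (simp only: inner_real_def sum.neutral_const)
qed

text \<open>The subsequence \<open>r\<close> is returned along with its limit so that \<omega> can
  later be placed in \<open>limsup_at_infinity\<close>.\<close>

lemma residual_bounded_limit:
  fixes B :: "real ^ 'l \<Rightarrow> 'n::finite tensor"
  assumes m: "m \<ge> 2"
    and K: "bounded K"
    and B: "tensor_continuous_on m (closure K) B"
    and p: "continuous_on (closure K) p"
    and v: "filterlim (\<lambda>k. norm (v k)) at_top sequentially"
    and w: "\<And>k. w k \<in> K"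
    and res: "\<And>k. residual m B p (v k) (w k) \<le> \<alpha>"
  obtains r :: "nat \<Rightarrow> nat" and \<omega> d where "strict_mono r" "(w \<circ> r) \<longlonglongrightarrow> \<omega>" "norm d = 1"
    "\<And>i. min (d $ i) (tensor_vec m (B \<omega>) d $ i) = 0"
proof -
  \<comment> \<open>Since \<open>sgn 0 = 0\<close>, the directions are placed in the ball rather
    than on the sphere; \<open>norm d = 1\<close> is recovered once \<open>v (r k)\<close> is
    eventually nonzero.\<close>
  have "compact (closure K \<times> cball 0 1 :: ((real ^ 'l) \<times> (real ^ 'n)) set)"
    using K by (intro compact_Times) (auto simp: compact_closure)
  moreover have "\<forall>k. (w k, sgn (v k)) \<in> closure K \<times> cball 0 1"
    using w closure_subset by (auto simp: norm_sgn)
  ultimately obtain l r where l: "l \<in> closure K \<times> cball 0 1" and r: "strict_mono r"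
    and lim: "((\<lambda>k. (w k, sgn (v k))) \<circ> r) \<longlonglongrightarrow> l"
    unfolding compact_eq_seq_compact_metric seq_compact_def by meson
  define \<omega> d where "\<omega> = fst l" and "d = snd l"
  have \<omega>: "(\<lambda>k. w (r k)) \<longlonglongrightarrow> \<omega>" and d: "(\<lambda>k. sgn (v (r k))) \<longlonglongrightarrow> d" and \<omega>K: "\<omega> \<in> closure K"
    using tendsto_fst[OF lim] tendsto_snd[OF lim] l by (auto simp: \<omega>_def d_def o_def)
  define t where "t k = norm (v (r k))" for k
  have t: "filterlim t at_top sequentially"
    using filterlim_compose[OF v filterlim_subseq[OF r]] by (simp add: t_def[abs_def])
  \<comment> \<open>The threshold 1, rather than mere positivity, yields
    \<open>t k \<le> t k ^ (m - 1)\<close> below.\<close>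
  then have t1: "\<forall>\<^sub>F k in sequentially. 1 \<le> t k"
    by (simp add: filterlim_at_top)
  have wK: "\<forall>\<^sub>F k in sequentially. w (r k) \<in> closure K"
    using w closure_subset by (intro always_eventually) blast
  have "(\<lambda>k. norm (sgn (v (r k)))) \<longlonglongrightarrow> 1"
    by (rule tendsto_eventually) (use t1 in eventually_elim, auto simp: norm_sgn t_def)
  with tendsto_norm[OF d] have d1: "norm d = 1"
    using LIMSEQ_unique by blast
  have "(\<lambda>k. B (w (r k)) is) \<longlonglongrightarrow> B \<omega> is" if "length is = m" for "is"
    using B that \<omega> \<omega>K wK
    by (intro continuous_on_tendsto_compose[where s = "closure K" and f = "\<lambda>\<omega>. B \<omega> is"])
       (auto simp: tensor_continuous_on_def)
  then have Blim: "(\<lambda>k. tensor_vec m (B (w (r k))) (sgn (v (r k)))) \<longlonglongrightarrow> tensor_vec m (B \<omega>) d"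
    using m d by (intro tendsto_tensor_vec) auto
  have plim: "(\<lambda>k. p (w (r k))) \<longlonglongrightarrow> p \<omega>"
    using continuous_on_tendsto_compose[OF p \<omega> \<omega>K wK] .
  have inv: "(\<lambda>k. inverse (t k)) \<longlonglongrightarrow> 0"
    using tendsto_inverse_0_at_top[OF t] .
  \<comment> \<open>Here \<open>m \<ge> 2\<close> matters: with exponent 0 the factor would be 1 and
    \<open>p\<close> would survive in the limit.\<close>
  have invm: "(\<lambda>k. inverse (t k) ^ (m - 1)) \<longlonglongrightarrow> 0"
    using tendsto_power[OF inv, of "m - 1"] m by (simp add: power_0_left)
  \<comment> \<open>For \<open>t k > 0\<close>, homogeneity of degree \<open>m - 1\<close> makes
    this the rescaled minimum. Its limits by continuity and by the residual bound must
    agree.\<close>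
  define f where "f i k = min (sgn (v (r k)) $ i)
    ((tensor_vec m (B (w (r k))) (sgn (v (r k))) + inverse (t k) ^ (m - 1) *\<^sub>R p (w (r k))) $ i)"
    for i k
  have "f i \<longlonglongrightarrow> min (d $ i) ((tensor_vec m (B \<omega>) d + 0 *\<^sub>R p \<omega>) $ i)" for i
    unfolding f_def by (intro tendsto_min tendsto_vec_nth tendsto_add tendsto_scaleR d Blim invm plim)
  moreover have "f i \<longlonglongrightarrow> 0" for i
  proof (rule Lim_null_comparison)
    show "(\<lambda>k. \<alpha> * inverse (t k)) \<longlonglongrightarrow> 0"
      using tendsto_mult_right_zero[OF inv] .
    show "\<forall>\<^sub>F k in sequentially. norm (f i k) \<le> \<alpha> * inverse (t k)"
      using t1
    proof eventually_elim
      case (elim k)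
      let ?T = "tensor_vec m (B (w (r k)))"
      have "\<bar>vec_min (v (r k)) (?T (v (r k)) + p (w (r k))) $ i\<bar> \<le> \<alpha>"
        using component_le_norm_cart res[of "r k"] unfolding residual_def by (rule order_trans)
      moreover have "t k \<le> t k ^ (m - 1)"
        using elim m by (intro self_le_power) auto
      ultimately have "\<bar>min (v (r k) $ i / t k) ((?T (v (r k)) + p (w (r k))) $ i / t k ^ (m - 1))\<bar>
          \<le> \<alpha> / t k"
        using elim by (intro abs_min_divide_le) (auto simp: vec_min_def)
      also have "min (v (r k) $ i / t k) ((?T (v (r k)) + p (w (r k))) $ i / t k ^ (m - 1)) = f i k"
        using elim
        by (simp add: f_def sgn_div_norm tensor_vec_scaleR flip: t_def)
           (simp add: field_simps)
      finally show ?case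
        by (simp add: divide_inverse)
    qed
  qed
  ultimately have "min (d $ i) (tensor_vec m (B \<omega>) d $ i) = 0" for i
    using LIMSEQ_unique by fastforce
  with r \<omega> d1 show ?thesis
    using that by (auto simp: o_def)
qed

theorem theorem3p6:
  fixes m :: nat
    and \<Omega> :: "real ^ 'n \<Rightarrow> (real ^ 'l) set"
    and B :: "real ^ 'l \<Rightarrow> 'n tensor"
    and p :: "real ^ 'l \<Rightarrow> real ^ 'n"
    and K :: "(real ^ 'l) set"
  assumes "m \<ge> 2"
    and "\<And>v. \<Omega> v \<noteq> {}"
    and "\<And>v. closed (\<Omega> v)"
    and "bounded K"
    and "\<And>v. \<Omega> v \<subseteq> K"
    and "tensor_continuous_on m (closure K) B"
    and "continuous_on (closure K) p"
    and "limit_R0 m B \<Omega>"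
  shows "level_bounded (merit m B p \<Omega>)"
  unfolding level_bounded_def
proof (intro allI impI, rule ccontr)
  fix \<alpha> :: real
  assume "\<not> bounded {v. merit m B p \<Omega> v \<le> \<alpha>}"
  then have "\<exists>v. merit m B p \<Omega> v \<le> \<alpha> \<and> real k \<le> norm v" for k
    unfolding bounded_iff by (metis linear mem_Collect_eq)
  then obtain v where v: "\<And>k. merit m B p \<Omega> (v k) \<le> \<alpha>" "\<And>k. real k \<le> norm (v k)"
    by metis
  have lim: "filterlim (\<lambda>k. norm (v k)) at_top sequentially"
    using v(2) by (intro filterlim_at_top_mono[OF filterlim_real_sequentially]) auto
  \<comment> \<open>The \<open>LEAST\<close> in \<open>merit\<close> is informative only if the
    minimum is attained, which compactness of \<open>\<Omega> (v k)\<close> ensures.\<close>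
  have "\<exists>\<omega>\<in>\<Omega> (v k). residual m B p (v k) \<omega> \<le> \<alpha>" for k
  proof -
    have sub: "\<Omega> (v k) \<subseteq> closure K"
      using assms(5) closure_subset by blast
    have "compact (\<Omega> (v k))"
      using assms(3) bounded_subset[OF assms(4,5)] by (simp add: compact_eq_bounded_closed)
    moreover have "tensor_continuous_on m (\<Omega> (v k)) B" "continuous_on (\<Omega> (v k)) p"
      using assms(6,7) sub continuous_on_subset unfolding tensor_continuous_on_def by blast+
    ultimately have "merit m B p \<Omega> (v k) \<in> residual m B p (v k) ` \<Omega> (v k)"
      using assms(1,2) by (intro merit_is_minimum) auto
    then show ?thesis
      using v(1)[of k] by auto
  qed
  then obtain w where w: "\<And>k. w k \<in> \<Omega> (v k)" "\<And>k. residual m B p (v k) (w k) \<le> \<alpha>"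
    by metis
  then have "\<And>k. w k \<in> K"
    using assms(5) by blast
  then obtain r \<omega> d where r: "strict_mono (r :: nat \<Rightarrow> nat)" "(w \<circ> r) \<longlonglongrightarrow> \<omega>" and "norm d = 1"
    and d: "\<And>i. min (d $ i) (tensor_vec m (B \<omega>) d $ i) = 0"
    using residual_bounded_limit[OF assms(1,4,6,7) lim _ w(2)] by blast
  \<comment> \<open>Passing to \<open>r\<close> in both sequences keeps the norms divergent and
    makes the parameters converge.\<close>
  have "\<omega> \<in> limsup_at_infinity \<Omega>"
    unfolding limsup_at_infinity_def
    using filterlim_compose[OF lim filterlim_subseq[OF r(1)]] r(2) w(1)
    by (intro CollectI exI[of _ "v \<circ> r"] exI[of _ "w \<circ> r"]) auto
  then have "d = 0"
    using assms(8) tensor_complementarity[OF d] unfolding limit_R0_def by blast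
  with \<open>norm d = 1\<close> show False
    by simp
qed

end
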